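(* Let $\mathcal{I}=\mathcal{I}\langle a_i,\varphi_i\rangle_{i<\omega}$ be a tall fragmented ideal, let $\bar L=\{L_n\}_{n<\omega}$ be a partition of $\omega$ into infinite sets, and let $\rho\in\omega^\omega$ with $\rho>0$. If $\lim_{i\to+\infty}\varphi_i(a_i)/\rho(i)=+\infty$, then $\mathfrak{b}(\mathcal{I})\leq\mathfrak{b}^\rho(\mathcal{I},\bar L)$.
   Context: A submeasure on a finite set $a$ is a map $\varphi:\mathcal{P}(a)\to[0,+\infty)$ with $\varphi(\varnothing)=0$, monotone, finitely subadditive. For a partition $\{a_i\}$ of $\omega$ into nonempty finite sets and submeasures $\varphi_i$ on $\mathcal{P}(a_i)$, $\mathcal{I}\langle a_i,\varphi_i\rangle_{i<\omega}=\{x\subseteq\omega: \{\varphi_i(x\cap a_i)\}_{i<\omega}\text{ bounded}\}$. An ideal is tall if every infinite $X\subseteq\omega$ contains an infinite member of the ideal. Put $A_n=\bigcup_{i\in L_n}a_i$ and $\mathcal{O}(\mathcal{I},\bar L)=\{Y\subseteq\omega: Y\cap A_n\in\mathcal{I}\text{ for all }n\}$. Let $S(2^{\bar a},\rho)$ be the set of functions $\psi$ on $\omega$ with $\psi(i)\subseteq\mathcal{P}(a_i)$ and $|\psi(i)|\leq\rho(i)$. For such $\psi$ and $Y\in\mathcal{O}(\mathcal{I},\bar L)$ write $\psi\ni' Y$ iff for every $n<\omega$ there are infinitely many $i\in L_n$ with $Y\cap a_i\in\psi(i)$. $\mathfrak{b}^\rho(\mathcal{I},\bar L)$ is the least size of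 a family $\Psi\subseteq S(2^{\bar a},\rho)$ such that for every $Y\in\mathcal{O}(\mathcal{I},\bar L)$ there is $\psi\in\Psi$ with $\psi\ni' Y$. For $A,B\subseteq\omega$, $A\subseteq_{\mathcal{I}}B$ iff $A\smallsetminus B\in\mathcal{I}$. A pair $\langle\mathcal{A},\mathcal{B}\rangle$ is $\mathcal{I}$-orthogonal if $A\cap B\in\mathcal{I}$ for all $A\in\mathcal{A},B\in\mathcal{B}$; $C$ separates it if $A\cap C\in\mathcal{I}$ for all $A\in\mathcal{A}$ and $B\subseteq_{\mathcal{I}}C$ for all $B\in\mathcal{B}$; an $\mathcal{I}$-gap is an unseparated $\mathcal{I}$-orthogonal pair. $\mathfrak{b}(\mathcal{I})$ is the least $\lambda$ such that there is an $\mathcal{I}$-gap $\langle\mathcal{A},\mathcal{B}\rangle$ with $|\mathcal{A}|=\aleph_0$, $|\mathcal{B}|=\lambda$. *)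

theory Defs
  imports Complex_Main "HOL-Library.Disjoint_Sets"
begin

unbundle cardinal_syntax

definition is_partition :: "(nat \<Rightarrow> nat set) \<Rightarrow> bool" where
  "is_partition a \<longleftrightarrow> disjoint_family a \<and> (\<Union>i. a i) = UNIV \<and> (\<forall>i. a i \<noteq> {})"

definition submeasure_on :: "'a set \<Rightarrow> ('a set \<Rightarrow> real) \<Rightarrow> bool" where
  "submeasure_on a \<phi> \<longleftrightarrow>
     finite a \<and>
     (\<forall>x. x \<subseteq> a \<longrightarrow> 0 \<le> \<phi> x) \<and>
     \<phi> {} = 0 \<and>
     (\<forall>x y. x \<subseteq> y \<and> y \<subseteq> a \<longrightarrow> \<phi> x \<le> \<phi> y) \<and>
     (\<forall>x y. x \<subseteq> a \<and> y \<subseteq> a \<longrightarrow> \<phi> (x \<union> y) \<le> \<phi> x + \<phi> y)"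

definition fragmentation :: "(nat \<Rightarrow> nat set) \<Rightarrow> (nat \<Rightarrow> nat set \<Rightarrow> real) \<Rightarrow> bool" where
  "fragmentation a \<phi> \<longleftrightarrow> is_partition a \<and> (\<forall>i. submeasure_on (a i) (\<phi> i))"

definition frag_ideal :: "(nat \<Rightarrow> nat set) \<Rightarrow> (nat \<Rightarrow> nat set \<Rightarrow> real) \<Rightarrow> nat set set" where
  "frag_ideal a \<phi> = {x. Bseq (\<lambda>i. \<phi> i (x \<inter> a i))}"

definition tall :: "nat set set \<Rightarrow> bool" where
  "tall I \<longleftrightarrow> (\<forall>X. infinite X \<longrightarrow> (\<exists>Y. Y \<subseteq> X \<and> infinite Y \<and> Y \<in> I))"

definition block :: "(nat \<Rightarrow> nat set) \<Rightarrow> (nat \<Rightarrow> nat set) \<Rightarrow> nat \<Rightarrow> nat set" where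
  "block a L n = (\<Union>i\<in>L n. a i)"

definition orth_blocks :: "(nat \<Rightarrow> nat set) \<Rightarrow> nat set set \<Rightarrow> (nat \<Rightarrow> nat set) \<Rightarrow> nat set set" where
  "orth_blocks a I L = {Y. \<forall>n. Y \<inter> block a L n \<in> I}"

definition slaloms :: "(nat \<Rightarrow> nat set) \<Rightarrow> (nat \<Rightarrow> nat) \<Rightarrow> (nat \<Rightarrow> nat set set) set" where
  "slaloms a \<rho> = {\<psi>. \<forall>i. \<psi> i \<subseteq> Pow (a i) \<and> card (\<psi> i) \<le> \<rho> i}"

definition anticipates ::
  "(nat \<Rightarrow> nat set) \<Rightarrow> (nat \<Rightarrow> nat set) \<Rightarrow> (nat \<Rightarrow> nat set set) \<Rightarrow> nat set \<Rightarrow> bool" where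
  "anticipates a L \<psi> Y \<longleftrightarrow> (\<forall>n. infinite {i \<in> L n. Y \<inter> a i \<in> \<psi> i})"

text \<open>The least cardinality of a member of a nonempty collection of sets; unspecified
  if the collection is empty.\<close>

definition least_card :: "'a set set \<Rightarrow> 'a rel" where
  "least_card F = |SOME X. X \<in> F \<and> (\<forall>Y\<in>F. |X| \<le>o |Y| )|"

lemma least_card_attained:
  assumes "F \<noteq> {}"
  shows "\<exists>X\<in>F. least_card F = |X| \<and> (\<forall>Y\<in>F. |X| \<le>o |Y| )"
proof -
  have "\<exists>r\<in>card_of ` F. \<forall>r'\<in>card_of ` F. r \<le>o r'"
    by (rule exists_minim_Card_order) (use assms in \<open>auto simp: card_of_Card_order\<close>)
  then have "\<exists>X. X \<in> F \<and> (\<forall>Y\<in>F. |X| \<le>o |Y| )" by auto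
  from someI_ex[OF this] show ?thesis unfolding least_card_def by blast
qed

definition anticipating_families ::
  "(nat \<Rightarrow> nat set) \<Rightarrow> (nat \<Rightarrow> nat) \<Rightarrow> nat set set \<Rightarrow> (nat \<Rightarrow> nat set) \<Rightarrow>
   (nat \<Rightarrow> nat set set) set set" where
  "anticipating_families a \<rho> I L =
     {\<Psi>. \<Psi> \<subseteq> slaloms a \<rho> \<and> (\<forall>Y\<in>orth_blocks a I L. \<exists>\<psi>\<in>\<Psi>. anticipates a L \<psi> Y)}"

definition b_slalom ::
  "(nat \<Rightarrow> nat set) \<Rightarrow> (nat \<Rightarrow> nat) \<Rightarrow> nat set set \<Rightarrow> (nat \<Rightarrow> nat set) \<Rightarrow>
   (nat \<Rightarrow> nat set set) rel" where
  "b_slalom a \<rho> I L = least_card (anticipating_families a \<rho> I L)"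

definition orthogonal_mod :: "'a set set \<Rightarrow> 'a set set \<Rightarrow> 'a set set \<Rightarrow> bool" where
  "orthogonal_mod I \<A> \<B> \<longleftrightarrow> (\<forall>A\<in>\<A>. \<forall>B\<in>\<B>. A \<inter> B \<in> I)"

definition subset_mod :: "'a set set \<Rightarrow> 'a set \<Rightarrow> 'a set \<Rightarrow> bool" where
  "subset_mod I A B \<longleftrightarrow> A - B \<in> I"

definition separates_mod :: "'a set set \<Rightarrow> 'a set \<Rightarrow> 'a set set \<Rightarrow> 'a set set \<Rightarrow> bool" where
  "separates_mod I C \<A> \<B> \<longleftrightarrow> (\<forall>A\<in>\<A>. A \<inter> C \<in> I) \<and> (\<forall>B\<in>\<B>. subset_mod I B C)"

definition gap_mod :: "'a set set \<Rightarrow> 'a set set \<Rightarrow> 'a set set \<Rightarrow> bool" where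
  "gap_mod I \<A> \<B> \<longleftrightarrow> orthogonal_mod I \<A> \<B> \<and> \<not> (\<exists>C. separates_mod I C \<A> \<B>)"

definition rothberger_sides :: "nat set set \<Rightarrow> nat set set set" where
  "rothberger_sides I = {\<B>. \<exists>\<A>. gap_mod I \<A> \<B> \<and> |\<A>| =o natLeq}"

definition b_ideal :: "nat set set \<Rightarrow> nat set rel" where
  "b_ideal I = least_card (rothberger_sides I)"

text \<open>Both invariants are minima over nonempty collections whenever \<open>\<rho> > 0\<close> and
  \<open>\<phi> i (a i) / \<rho> i\<close> tends to infinity, since then \<open>\<phi> i (a i)\<close> tends to infinity as well.\<close>

lemma anticipating_families_nonempty:
  assumes "\<And>n. infinite (L n)" and "\<And>i. 0 < \<rho> i"
  shows "anticipating_families a \<rho> I L \<noteq> {}"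
proof -
  have "slaloms a \<rho> \<in> anticipating_families a \<rho> I L"
    unfolding anticipating_families_def
  proof (intro CollectI conjI ballI)
    fix Y
    have "(\<lambda>i. {Y \<inter> a i}) \<in> slaloms a \<rho>"
      using assms(2) by (auto simp: slaloms_def Suc_le_eq)
    moreover have "anticipates a L (\<lambda>i. {Y \<inter> a i}) Y"
      using assms(1) by (simp add: anticipates_def)
    ultimately show "\<exists>\<psi>\<in>slaloms a \<rho>. anticipates a L \<psi> Y" by blast
  qed simp
  then show ?thesis by blast
qed

lemma rothberger_sides_nonempty:
  assumes frag: "fragmentation a \<phi>"
    and L: "is_partition L" "\<And>n. infinite (L n)"
    and lim: "filterlim (\<lambda>i. \<phi> i (a i)) at_top sequentially"
  shows "rothberger_sides (frag_ideal a \<phi>) \<noteq> {}"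
proof -
  let ?I = "frag_ideal a \<phi>" and ?A = "block a L"
  have sub: "submeasure_on (a i) (\<phi> i)" for i
    using frag by (simp add: fragmentation_def)
  have zero: "\<phi> i {} = 0" for i using sub[of i] by (simp add: submeasure_on_def)
  have mono: "\<phi> i x \<le> \<phi> i y" if "x \<subseteq> y" "y \<subseteq> a i" for i x y
    using sub[of i] that by (simp add: submeasure_on_def)
  have subadd: "\<phi> i (x \<union> y) \<le> \<phi> i x + \<phi> i y" if "x \<subseteq> a i" "y \<subseteq> a i" for i x y
    using sub[of i] that by (simp add: submeasure_on_def)
  have disj: "k \<in> a i \<Longrightarrow> k \<in> a j \<Longrightarrow> i = j" for i j k
    using frag unfolding fragmentation_def is_partition_def disjoint_family_on_def by blast
  have ne: "a i \<noteq> {}" for i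
    using frag unfolding fragmentation_def is_partition_def by blast
  have Ldisj: "i \<in> L m \<Longrightarrow> i \<in> L n \<Longrightarrow> m = n" for i m n
    using L(1) unfolding is_partition_def disjoint_family_on_def by blast
  have Lne: "L n \<noteq> {}" for n using L(1) by (simp add: is_partition_def)
  have Aint: "?A n \<inter> a i = a i" if "i \<in> L n" for n i
    using that by (auto simp: block_def)
  have "inj ?A"
  proof (rule injI)
    fix m n assume eq: "?A m = ?A n"
    obtain i where i: "i \<in> L m" using Lne by blast
    obtain k where k: "k \<in> a i" using ne by blast
    have "k \<in> ?A n" using i k eq by (auto simp: block_def)
    then obtain j where "j \<in> L n" "k \<in> a j" by (auto simp: block_def)
    then show "m = n" using disj k i Ldisj by blast
  qed
  then have card: "|range ?A| =o natLeq"
    using card_of_ordIsoI[OF inj_on_imp_bij_betw] card_of_nat ordIso_symmetric ordIso_transitive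
    by blast
  have nosep: "\<not> separates_mod ?I C (range ?A) (orth_blocks a ?I L)" for C
  proof
    assume sep: "separates_mod ?I C (range ?A) (orth_blocks a ?I L)"
    have "\<exists>i\<in>L n. real n \<le> \<phi> i (a i - C)" for n
    proof -
      have "?A n \<inter> C \<in> ?I" using sep by (auto simp: separates_mod_def)
      then obtain K where K: "\<And>i. norm (\<phi> i ((?A n \<inter> C) \<inter> a i)) \<le> K"
        unfolding frag_ideal_def Bseq_def by blast
      have "eventually (\<lambda>i. real n + K \<le> \<phi> i (a i)) sequentially"
        using lim by (simp add: filterlim_at_top)
      then obtain N where N: "\<And>i. N \<le> i \<Longrightarrow> real n + K \<le> \<phi> i (a i)"
        by (auto simp: eventually_sequentially)
      obtain i where i: "i \<in> L n" "N \<le> i"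
        using L(2)[of n] by (metis finite_nat_set_iff_bounded linorder_not_less)
      have "(?A n \<inter> C) \<inter> a i = a i \<inter> C" using Aint[OF i(1)] by blast
      then have "\<phi> i (a i \<inter> C) \<le> K" using K[of i] by simp
      moreover have "\<phi> i (a i) \<le> \<phi> i (a i \<inter> C) + \<phi> i (a i - C)"
        using subadd[of "a i \<inter> C" i "a i - C"] by (simp add: Int_Diff_Un)
      ultimately show ?thesis using i N[of i] by force
    qed
    then obtain g where g: "\<And>n. g n \<in> L n" "\<And>n. real n \<le> \<phi> (g n) (a (g n) - C)"
      by metis
    define B where "B = (\<Union>n. a (g n) - C)"
    have Bg: "B \<inter> a (g n) = a (g n) - C" for n
      unfolding B_def using disj by blast
    have B0: "B \<inter> ?A n \<inter> a i = {}" if "i \<noteq> g n" for n i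
    proof (rule ccontr)
      assume "B \<inter> ?A n \<inter> a i \<noteq> {}"
      then obtain k m j where "k \<in> a (g m)" "j \<in> L n" "k \<in> a j" "k \<in> a i"
        by (auto simp: B_def block_def)
      then have "g m = i" "g m \<in> L n" using disj by blast+
      then show False using g(1)[of m] Ldisj that by blast
    qed
    have "B \<in> orth_blocks a ?I L"
      unfolding orth_blocks_def frag_ideal_def
    proof (intro CollectI allI)
      fix n
      have "norm (\<phi> i (B \<inter> ?A n \<inter> a i)) \<le> norm (\<phi> (g n) (B \<inter> ?A n \<inter> a (g n)))" for i
        using B0[of i n] zero by (cases "i = g n") auto
      then show "Bseq (\<lambda>i. \<phi> i (B \<inter> ?A n \<inter> a i))" by (rule BseqI')
    qed
    then have "B - C \<in> ?I" using sep by (simp add: separates_mod_def subset_mod_def)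
    then obtain K where K: "\<And>i. norm (\<phi> i ((B - C) \<inter> a i)) \<le> K"
      unfolding frag_ideal_def Bseq_def by blast
    obtain n where n: "K < real n" using reals_Archimedean2 by blast
    have "(B - C) \<inter> a (g n) = a (g n) - C" using Bg[of n] by blast
    then show False using K[of "g n"] g(2)[of n] n by simp
  qed
  have "orthogonal_mod ?I (range ?A) (orth_blocks a ?I L)"
    by (auto simp: orthogonal_mod_def orth_blocks_def Int_commute)
  then have "gap_mod ?I (range ?A) (orth_blocks a ?I L)"
    using nosep by (simp add: gap_mod_def)
  then show ?thesis using card unfolding rothberger_sides_def by blast
qed

end

theory Submission
  imports Defs
begin

text \<open>
  Tallness bounds the submeasures of all singletons by one constant \<open>K\<close>, so every subset of
  \<open>a\<^sub>i\<close> of submeasure at least \<open>t\<close> contains a set whose submeasure lies between \<open>t\<close> and \<open>t + K\<close>.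
  Given a slalom \<open>\<psi>\<close>, discard from \<open>\<psi>(i)\<close> the sets of submeasure more than half of
  \<open>\<phi>\<^sub>i(a\<^sub>i)/\<rho>(i)\<close>. At most \<open>\<rho>(i)\<close> sets remain, so the complement in \<open>a\<^sub>i\<close> of their
  union still has submeasure at least \<open>\<phi>\<^sub>i(a\<^sub>i)/2\<close>. For \<open>i \<in> L\<^sub>n\<close> choose in this complement a
  set \<open>b\<^sub>i\<close> of submeasure about \<open>n\<close>, and let \<open>B\<^sub>\<psi>\<close> be the union of the \<open>b\<^sub>i\<close>. Then \<open>B\<^sub>\<psi>\<close> is
  orthogonal to every block \<open>A\<^sub>n\<close>. If \<open>C\<close> is orthogonal to all the blocks and \<open>\<psi>\<close> anticipates \<open>C\<close>,
  then for each \<open>n\<close> some \<open>b\<^sub>i\<close> of submeasure at least \<open>n\<close> misses \<open>C\<close>. Hence the sets \<open>B\<^sub>\<psi>\<close>, for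
  \<open>\<psi>\<close> in an anticipating family, form a gap with the blocks.
\<close>

lemma submeasure_on_zero: "submeasure_on a \<phi> \<Longrightarrow> \<phi> {} = 0"
  by (simp add: submeasure_on_def)

lemma submeasure_on_nonneg: "submeasure_on a \<phi> \<Longrightarrow> x \<subseteq> a \<Longrightarrow> 0 \<le> \<phi> x"
  by (simp add: submeasure_on_def)

lemma submeasure_on_mono: "submeasure_on a \<phi> \<Longrightarrow> x \<subseteq> y \<Longrightarrow> y \<subseteq> a \<Longrightarrow> \<phi> x \<le> \<phi> y"
  by (simp add: submeasure_on_def)

lemma submeasure_on_Un_le:
  "submeasure_on a \<phi> \<Longrightarrow> x \<subseteq> a \<Longrightarrow> y \<subseteq> a \<Longrightarrow> \<phi> (x \<union> y) \<le> \<phi> x + \<phi> y"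
  by (simp add: submeasure_on_def)

lemma submeasure_on_Union_le:
  assumes sub: "submeasure_on a \<phi>" and "finite X" and "\<And>x. x \<in> X \<Longrightarrow> x \<subseteq> a \<and> \<phi> x \<le> M"
  shows "\<phi> (\<Union>X) \<le> real (card X) * M"
  using assms(2,3)
proof (induction X rule: finite_induct)
  case empty
  then show ?case using submeasure_on_zero[OF sub] by simp
next
  case (insert x X)
  have "\<phi> (x \<union> \<Union>X) \<le> \<phi> x + \<phi> (\<Union>X)"
    using insert.prems by (intro submeasure_on_Un_le[OF sub]) auto
  moreover have "\<phi> x \<le> M" using insert.prems by blast
  moreover have "\<phi> (\<Union>X) \<le> real (card X) * M" using insert by blast
  ultimately show ?case using insert.hyps by (simp add: algebra_simps)
qed

text \<open>One further point raises \<phi> by at most \<open>K\<close>, so collecting the points of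
  \<open>U\<close> one by one and stopping once \<open>t\<close> is reached overshoots by at most
  \<open>K\<close>. If \<open>t\<close> is never reached, \<open>b\<close> is all of
  \<open>U\<close>.\<close>

lemma submeasure_on_intermediate:
  assumes sub: "submeasure_on a \<phi>" and single: "\<And>k. k \<in> a \<Longrightarrow> \<phi> {k} \<le> K"
    and "0 \<le> K" and "0 \<le> t" and "U \<subseteq> a"
  shows "\<exists>b\<subseteq>U. \<phi> b \<le> t + K \<and> (t \<le> \<phi> U \<longrightarrow> t \<le> \<phi> b)"
proof -
  have "finite U"
    using sub \<open>U \<subseteq> a\<close> finite_subset by (auto simp: submeasure_on_def)
  then have "\<exists>b\<subseteq>U. \<phi> b \<le> t + K \<and> (t \<le> \<phi> b \<or> b = U)"
    using \<open>U \<subseteq> a\<close>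
  proof (induction U rule: finite_induct)
    case empty
    then show ?case using submeasure_on_zero[OF sub] assms(3,4) by simp
  next
    case (insert k U)
    then obtain b where b: "b \<subseteq> U" "\<phi> b \<le> t + K" "t \<le> \<phi> b \<or> b = U" by auto
    show ?case
    proof (cases "t \<le> \<phi> b")
      case True
      then show ?thesis using b by blast
    next
      case False
      then have "b = U" using b by blast
      moreover have "\<phi> ({k} \<union> U) \<le> \<phi> {k} + \<phi> U"
        using insert.prems by (intro submeasure_on_Un_le[OF sub]) auto
      moreover have "\<phi> {k} \<le> K" using single insert.prems by blast
      ultimately have "\<phi> (insert k U) \<le> t + K" using False by simp
      then show ?thesis by blast
    qed
  qed
  then show ?thesis by blast
qed

text \<open>Otherwise there are points \<open>g n\<close> whose singletons have submeasure above
  \<open>n\<close>, and the infinite set \<open>range g\<close> has no infinite subset in the ideal,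
  against tallness.\<close>

lemma tall_frag_ideal_singletons_bounded:
  assumes frag: "fragmentation a \<phi>" and tall: "tall (frag_ideal a \<phi>)"
  shows "\<exists>K\<ge>0. \<forall>i. \<forall>k\<in>a i. \<phi> i {k} \<le> K"
proof (rule ccontr)
  assume contra: "\<not> ?thesis"
  have sub: "submeasure_on (a i) (\<phi> i)" for i
    using frag by (simp add: fragmentation_def)
  have "\<exists>i k. k \<in> a i \<and> real n < \<phi> i {k}" for n
    using contra by (metis not_less of_nat_0_le_iff)
  then obtain f g where g: "\<And>n. g n \<in> a (f n)" "\<And>n. real n < \<phi> (f n) {g n}"
    by metis
  have fin: "finite Y" if Y: "Y \<subseteq> range g" "Y \<in> frag_ideal a \<phi>" for Y
  proof -
    obtain M where M: "\<And>i. norm (\<phi> i (Y \<inter> a i)) \<le> M"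
      using Y(2) unfolding frag_ideal_def Bseq_def by blast
    have "n \<le> nat \<lceil>M\<rceil>" if "g n \<in> Y" for n
    proof -
      have "\<phi> (f n) {g n} \<le> \<phi> (f n) (Y \<inter> a (f n))"
        using g(1)[of n] that by (intro submeasure_on_mono[OF sub]) auto
      then have "real n \<le> M" using g(2)[of n] M[of "f n"] by simp
      then show ?thesis by linarith
    qed
    then have "Y \<subseteq> g ` {..nat \<lceil>M\<rceil>}" using Y(1) by auto
    then show ?thesis by (rule finite_subset) simp
  qed
  \<comment> \<open>The \<open>g n\<close> may repeat, but a point \<open>k\<close> lies in only one
    \<open>a i\<close>, so \<open>g n = k\<close> forces \<open>n\<close> below the fixed number
    \<open>\<phi> i {k}\<close>.\<close>
  have "infinite (range g)"
  proof
    assume "finite (range g)"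
    then obtain k where "infinite {n. g n = k}"
      using pigeonhole_infinite[of UNIV g] by auto
    obtain i where i: "k \<in> a i"
      using frag unfolding fragmentation_def is_partition_def by blast
    have "n \<le> nat \<lceil>\<phi> i {k}\<rceil>" if "g n = k" for n
    proof -
      have "f n = i"
        using g(1)[of n] i that frag
        unfolding fragmentation_def is_partition_def disjoint_family_on_def by blast
      then have "real n < \<phi> i {k}" using g(2)[of n] that by simp
      then show ?thesis by linarith
    qed
    then have "{n. g n = k} \<subseteq> {..nat \<lceil>\<phi> i {k}\<rceil>}" by blast
    then show False using \<open>infinite {n. g n = k}\<close> finite_subset by blast
  qed
  then show False using tall fin unfolding tall_def by blast
qed

text \<open>The countable side of a gap is measured as a set, so the blocks have to be pairwise
  distinct.\<close>

lemma inj_block: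
  assumes a: "is_partition a" and L: "is_partition L"
  shows "inj (block a L)"
proof (rule injI)
  fix m n assume eq: "block a L m = block a L n"
  obtain i where i: "i \<in> L m" using L by (force simp: is_partition_def)
  obtain k where k: "k \<in> a i" using a by (force simp: is_partition_def)
  obtain j where j: "j \<in> L n" "k \<in> a j"
    using i k eq by (auto simp: block_def)
  have "i = j"
    using a j(2) k unfolding is_partition_def disjoint_family_on_def by blast
  then show "m = n"
    using L i j(1) unfolding is_partition_def disjoint_family_on_def by blast
qed

text \<open>The upper bound \<open>t + K\<close> is unconditional because a set \<open>b\<close>
  gets chosen for every index, also where \<phi> of the whole piece is still too small for the lower
  bound.\<close>

lemma exists_set_avoiding_slalom:
  assumes sub: "submeasure_on a \<phi>" and single: "\<And>k. k \<in> a \<Longrightarrow> \<phi> {k} \<le> K"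
    and "0 \<le> K" and "0 \<le> t"
    and S: "S \<subseteq> Pow a" "card S \<le> r" and "0 < r"
  shows "\<exists>b\<subseteq>a. \<phi> b \<le> t + K \<and>
    (t \<le> \<phi> a / real r / 2 \<longrightarrow>
      t \<le> \<phi> b \<and> (\<forall>x\<in>S. \<phi> x \<le> \<phi> a / real r / 2 \<longrightarrow> b \<inter> x = {}))"
proof -
  define q where "q = \<phi> a / real r"
  define T where "T = {x \<in> S. \<phi> x \<le> q / 2}"
  have q0: "0 \<le> q" using submeasure_on_nonneg[OF sub, of a] by (simp add: q_def)
  have fin: "finite S" using sub S(1) finite_subset by (auto simp: submeasure_on_def)
  have T: "T \<subseteq> S" "\<Union>T \<subseteq> a" using S(1) by (auto simp: T_def)
  obtain b where b: "b \<subseteq> a - \<Union>T" "\<phi> b \<le> t + K" "t \<le> \<phi> (a - \<Union>T) \<longrightarrow> t \<le> \<phi> b"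
    using submeasure_on_intermediate[OF sub single assms(3,4), of "a - \<Union>T"] by blast
  have "t \<le> \<phi> b" if t: "t \<le> q / 2"
  proof -
    have "\<phi> (\<Union>T) \<le> real (card T) * (q / 2)"
      using T S(1) fin by (intro submeasure_on_Union_le[OF sub]) (auto simp: T_def)
    also have "\<dots> \<le> real r * (q / 2)"
      using card_mono[OF fin T(1)] S(2) q0 by (intro mult_right_mono) auto
    finally have "\<phi> (\<Union>T) \<le> real r * (q / 2)" .
    moreover have "\<phi> a \<le> \<phi> (\<Union>T) + \<phi> (a - \<Union>T)"
      using submeasure_on_Un_le[OF sub T(2), of "a - \<Union>T"] T(2) by (simp add: Un_absorb1)
    moreover have "\<phi> a = real r * q" using \<open>0 < r\<close> by (simp add: q_def)
    \<comment> \<open>The complement of \<open>\<Union>T\<close> keeps at least half of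
      \<open>\<phi> a = r * q\<close>; since \<open>r\<close> is at least 1, this is at least
      \<open>q / 2\<close>, hence at least \<open>t\<close>.\<close>
    moreover have "1 * (q / 2) \<le> real r * (q / 2)"
      using q0 \<open>0 < r\<close> by (intro mult_right_mono) auto
    ultimately have "t \<le> \<phi> (a - \<Union>T)" using t by simp
    then show ?thesis using b(3) by blast
  qed
  moreover have "b \<subseteq> a" using b(1) by blast
  moreover have "b \<inter> x = {}" if "x \<in> S" "\<phi> x \<le> q / 2" for x
    using b(1) that by (auto simp: T_def)
  ultimately show ?thesis using b(2) unfolding q_def by blast
qed

lemma slalom_witness:
  assumes frag: "fragmentation a \<phi>"
    and K: "0 \<le> K" "\<And>i k. k \<in> a i \<Longrightarrow> \<phi> i {k} \<le> K"
    and L: "is_partition L"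
    and \<rho>: "\<And>i. 0 < \<rho> i"
    and lim: "filterlim (\<lambda>i. \<phi> i (a i) / real (\<rho> i)) at_top sequentially"
    and \<psi>: "\<psi> \<in> slaloms a \<rho>"
  shows "\<exists>B\<in>orth_blocks a (frag_ideal a \<phi>) L.
    \<forall>C\<in>orth_blocks a (frag_ideal a \<phi>) L. anticipates a L \<psi> C \<longrightarrow> B - C \<notin> frag_ideal a \<phi>"
proof -
  let ?q = "\<lambda>i. \<phi> i (a i) / real (\<rho> i)"
  have sub: "submeasure_on (a i) (\<phi> i)" for i
    using frag by (simp add: fragmentation_def)
  have disj: "k \<in> a i \<Longrightarrow> k \<in> a j \<Longrightarrow> i = j" for i j k
    using frag unfolding fragmentation_def is_partition_def disjoint_family_on_def by blast
  have Ldisj: "i \<in> L m \<Longrightarrow> i \<in> L n \<Longrightarrow> m = n" for i m n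
    using L unfolding is_partition_def disjoint_family_on_def by blast
  have "\<exists>n. i \<in> L n" for i using L by (auto simp: is_partition_def)
  \<comment> \<open>The target submeasure at \<open>i\<close> is the number \<open>N i\<close> of
    its block: constant on each block, so that \<open>B\<close> is bounded there, yet unbounded over
    all blocks.\<close>
  then obtain N where N: "\<And>i. i \<in> L (N i)" by metis
  have "\<exists>b\<subseteq>a i. \<phi> i b \<le> real (N i) + K \<and>
      (real (N i) \<le> ?q i / 2 \<longrightarrow>
        real (N i) \<le> \<phi> i b \<and> (\<forall>x\<in>\<psi> i. \<phi> i x \<le> ?q i / 2 \<longrightarrow> b \<inter> x = {}))" for i
    using \<psi> by (intro exists_set_avoiding_slalom[OF sub K(2) K(1) _ _ _ \<rho>])
      (auto simp: slaloms_def)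
  then obtain b where b: "\<And>i. b i \<subseteq> a i" "\<And>i. \<phi> i (b i) \<le> real (N i) + K"
    "\<And>i. real (N i) \<le> ?q i / 2 \<Longrightarrow> real (N i) \<le> \<phi> i (b i)"
    "\<And>i x. real (N i) \<le> ?q i / 2 \<Longrightarrow> x \<in> \<psi> i \<Longrightarrow> \<phi> i x \<le> ?q i / 2 \<Longrightarrow> b i \<inter> x = {}"
    by metis
  define B where "B = (\<Union>i. b i)"
  have Ba: "B \<inter> a i = b i" for i unfolding B_def using b(1) disj by blast
  have blk: "block a L n \<inter> a i = (if N i = n then a i else {})" for n i
  proof -
    have "N i = n" if "x \<in> a i" "j \<in> L n" "x \<in> a j" for x j
      using disj[OF that(1,3)] that(2) N Ldisj by blast
    then show ?thesis using N by (auto simp: block_def)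
  qed
  have "B \<in> orth_blocks a (frag_ideal a \<phi>) L"
    unfolding orth_blocks_def frag_ideal_def
  proof (intro CollectI allI)
    fix n
    have "norm (\<phi> i (B \<inter> block a L n \<inter> a i)) \<le> real n + K" for i
    proof (cases "N i = n")
      case True
      then have "B \<inter> block a L n \<inter> a i = b i" using blk[of n i] Ba[of i] by auto
      then show ?thesis using b(2)[of i] submeasure_on_nonneg[OF sub b(1)] True by simp
    next
      case False
      then have "B \<inter> block a L n \<inter> a i = {}" using blk[of n i] by auto
      then show ?thesis using submeasure_on_zero[OF sub] K(1) by simp
    qed
    then show "Bseq (\<lambda>i. \<phi> i (B \<inter> block a L n \<inter> a i))" by (rule BseqI')
  qed
  moreover have "B - C \<notin> frag_ideal a \<phi>"
    if C: "C \<in> orth_blocks a (frag_ideal a \<phi>) L" and ant: "anticipates a L \<psi> C" for C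
  proof
    assume "B - C \<in> frag_ideal a \<phi>"
    then obtain M where M: "\<And>i. norm (\<phi> i ((B - C) \<inter> a i)) \<le> M"
      unfolding frag_ideal_def Bseq_def by blast
    obtain n where n: "M < real n" using reals_Archimedean2 by blast
    have "C \<inter> block a L n \<in> frag_ideal a \<phi>" using C by (simp add: orth_blocks_def)
    then obtain M' where M': "\<And>i. norm (\<phi> i (C \<inter> block a L n \<inter> a i)) \<le> M'"
      unfolding frag_ideal_def Bseq_def by blast
    \<comment> \<open>From \<open>i0\<close> on, half of \<open>?q i\<close> exceeds or equals both
      the target \<open>n\<close> and the bound \<open>M'\<close> of \<open>C\<close> on block
      \<open>n\<close>. So \<open>b i\<close> reaches \<open>n\<close>, and
      \<open>C \<inter> a i\<close> is small enough to be among the sets that \<open>b i\<close>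
      avoids.\<close>
    have "eventually (\<lambda>i. 2 * max (real n) M' \<le> ?q i) sequentially"
      using lim by (simp add: filterlim_at_top)
    then obtain i0 where i0: "\<And>i. i0 \<le> i \<Longrightarrow> 2 * max (real n) M' \<le> ?q i"
      by (auto simp: eventually_sequentially)
    \<comment> \<open>Infinitely many guesses inside one block are what supplies a correct guess
      beyond \<open>i0\<close>.\<close>
    have "infinite {i \<in> L n. C \<inter> a i \<in> \<psi> i}" using ant by (simp add: anticipates_def)
    then obtain i where i: "i \<in> L n" "C \<inter> a i \<in> \<psi> i" "i0 \<le> i"
      unfolding finite_nat_set_iff_bounded by (auto simp: not_less)
    have Ni: "N i = n" using N Ldisj i(1) by blast
    have q: "real n \<le> ?q i / 2" "M' \<le> ?q i / 2" using i0[OF i(3)] by auto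
    have "C \<inter> block a L n \<inter> a i = C \<inter> a i" using blk[of n i] Ni by auto
    then have "\<phi> i (C \<inter> a i) \<le> ?q i / 2" using M'[of i] q(2) by simp
    then have "b i \<inter> (C \<inter> a i) = {}" using b(4) i(2) q(1) Ni by blast
    then have "(B - C) \<inter> a i = b i" using Ba[of i] b(1)[of i] by blast
    moreover have "real n \<le> \<phi> i (b i)" using b(3)[of i] q(1) Ni by simp
    ultimately show False using M[of i] n by simp
  qed
  ultimately show ?thesis by blast
qed

lemma anticipating_family_gives_rothberger_side:
  assumes frag: "fragmentation a \<phi>" and tall: "tall (frag_ideal a \<phi>)"
    and L: "is_partition L"
    and \<rho>: "\<And>i. 0 < \<rho> i"
    and lim: "filterlim (\<lambda>i. \<phi> i (a i) / real (\<rho> i)) at_top sequentially"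
    and \<Psi>: "\<Psi> \<in> anticipating_families a \<rho> (frag_ideal a \<phi>) L"
  shows "\<exists>\<B>\<in>rothberger_sides (frag_ideal a \<phi>). |\<B>| \<le>o |\<Psi>|"
proof -
  let ?I = "frag_ideal a \<phi>"
  obtain K where K: "0 \<le> K" "\<And>i k. k \<in> a i \<Longrightarrow> \<phi> i {k} \<le> K"
    using tall_frag_ideal_singletons_bounded[OF frag tall] by blast
  have \<Psi>_slaloms: "\<psi> \<in> slaloms a \<rho>" if "\<psi> \<in> \<Psi>" for \<psi>
    using \<Psi> that by (auto simp: anticipating_families_def)
  have "\<forall>\<psi>\<in>\<Psi>. \<exists>B. B \<in> orth_blocks a ?I L \<and>
      (\<forall>C\<in>orth_blocks a ?I L. anticipates a L \<psi> C \<longrightarrow> B - C \<notin> ?I)"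
    using slalom_witness[OF frag K L \<rho> lim \<Psi>_slaloms] by blast
  then obtain B where B: "\<And>\<psi>. \<psi> \<in> \<Psi> \<Longrightarrow> B \<psi> \<in> orth_blocks a ?I L"
    "\<And>\<psi> C. \<psi> \<in> \<Psi> \<Longrightarrow> C \<in> orth_blocks a ?I L \<Longrightarrow> anticipates a L \<psi> C \<Longrightarrow> B \<psi> - C \<notin> ?I"
    by metis
  have "orthogonal_mod ?I (range (block a L)) (B ` \<Psi>)"
    using B(1) by (auto simp: orthogonal_mod_def orth_blocks_def Int_commute)
  moreover have "\<not> separates_mod ?I C (range (block a L)) (B ` \<Psi>)" for C
  proof
    assume sep: "separates_mod ?I C (range (block a L)) (B ` \<Psi>)"
    \<comment> \<open>Half of being a separator is orthogonality to every block, which puts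
      \<open>C\<close> within reach of \<Psi>.\<close>
    then have C: "C \<in> orth_blocks a ?I L"
      by (auto simp: separates_mod_def orth_blocks_def Int_commute)
    then obtain \<psi> where \<psi>: "\<psi> \<in> \<Psi>" "anticipates a L \<psi> C"
      using \<Psi> by (auto simp: anticipating_families_def)
    then have "B \<psi> - C \<in> ?I" using sep by (simp add: separates_mod_def subset_mod_def)
    then show False using B(2) C \<psi> by blast
  qed
  moreover have "|range (block a L)| =o natLeq"
    using inj_block[OF _ L] frag card_of_ordIsoI[OF inj_on_imp_bij_betw] card_of_nat
      ordIso_symmetric ordIso_transitive
    unfolding fragmentation_def by blast
  ultimately have "B ` \<Psi> \<in> rothberger_sides ?I"
    unfolding rothberger_sides_def gap_mod_def by blast
  then show ?thesis using card_of_image by blast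
qed

theorem theorem5p2:
  fixes a :: "nat \<Rightarrow> nat set" and \<phi> :: "nat \<Rightarrow> nat set \<Rightarrow> real"
    and L :: "nat \<Rightarrow> nat set" and \<rho> :: "nat \<Rightarrow> nat"
    and I :: "nat set set"
  assumes "fragmentation a \<phi>" and "I = frag_ideal a \<phi>" and "tall I"
    and "is_partition L" and "\<And>n. infinite (L n)"
    and "\<And>i. 0 < \<rho> i"
    and "filterlim (\<lambda>i. \<phi> i (a i) / real (\<rho> i)) at_top sequentially"
  shows "b_ideal I \<le>o b_slalom a \<rho> I L"
proof -
  obtain \<Psi> where \<Psi>: "\<Psi> \<in> anticipating_families a \<rho> I L" "b_slalom a \<rho> I L = |\<Psi>|"
    using least_card_attained[OF anticipating_families_nonempty[of L \<rho> a I, OF assms(5,6)]]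
    unfolding b_slalom_def by blast
  obtain \<B> where \<B>: "\<B> \<in> rothberger_sides I" "|\<B>| \<le>o |\<Psi>|"
    using anticipating_family_gives_rothberger_side[OF assms(1) _ assms(4,6,7)] assms(2,3) \<Psi>(1)
    by blast
  \<comment> \<open>\<open>least_card\<close> is meaningful only on nonempty collections; the gap
    just obtained provides a member.\<close>
  then have "rothberger_sides I \<noteq> {}" by blast
  then have "b_ideal I \<le>o |\<B>|"
    using least_card_attained[of "rothberger_sides I"] \<B>(1) unfolding b_ideal_def by force
  then show ?thesis using \<B>(2) \<Psi>(2) ordLeq_transitive by fastforce
qed

end
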